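(* Let $A_1,A_2$ be Hermitian $n\times n$ complex matrices. Then $$s(A_1-A_2)\prec_w \mathrm{Spr}^+(A_1\oplus A_2).$$
   Context: For a Hermitian $m\times m$ complex matrix $A$, $\lambda(A)=(\lambda_1(A),\dots,\lambda_m(A))$ denotes its eigenvalues, counted with multiplicity, in non-increasing order. The spectral spread of $A$ is $\mathrm{Spr}^+(A)=(\lambda_i(A)-\lambda_{m-i+1}(A))_{1\le i\le [m/2]}\in\mathbb{R}_{\ge 0}^{[m/2]}$, where $[\cdot]$ is the integer part. $A_1\oplus A_2$ is the $2n\times 2n$ block diagonal matrix with diagonal blocks $A_1,A_2$; thus $\mathrm{Spr}^+(A_1\oplus A_2)\in\mathbb{R}^n_{\ge0}$. For an $n\times n$ complex matrix $C$, $s(C)=\lambda((C^*C)^{1/2})\in\mathbb{R}_{\ge0}^n$ is the vector of singular values in non-increasing order. Submajorization: for $x,y\in\mathbb{R}^n$, $x\prec_w y$ means $\sum_{i=1}^j x_i^{\downarrow}\le\sum_{i=1}^j y_i^{\downarrow}$ for all $1\le j\le n$, where $x^{\downarrow}$ is the non-increasing rearrangement of $x$. *)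

theory Defs
  imports
    "Jordan_Normal_Form.Schur_Decomposition"
    "HOL-Computational_Algebra.Fundamental_Theorem_Algebra"
begin

definition hermitian_mat :: "complex mat \<Rightarrow> bool" where
  "hermitian_mat A \<longleftrightarrow> mat_adjoint A = A"

definition psd_mat :: "complex mat \<Rightarrow> bool" where
  "psd_mat A \<longleftrightarrow> hermitian_mat A \<and>
     (\<forall>v \<in> carrier_vec (dim_row A). 0 \<le> Re ((A *\<^sub>v v) \<bullet>c v))"

(* The roots of the characteristic polynomial of a Hermitian matrix are real, so nothing is
   lost by taking real parts; eigvals is only meant for Hermitian arguments.
   Eigenvalues, singular values and spreads are lists, so the indices below start at 0. *)
definition eigvals :: "complex mat \<Rightarrow> real list" where
  "eigvals A = rev (sorted_list_of_multiset (image_mset Re (proots (char_poly A))))"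

(* The unique positive semidefinite square root; only meant for positive semidefinite A. *)
definition psd_sqrt :: "complex mat \<Rightarrow> complex mat" where
  "psd_sqrt A = (THE B. psd_mat B \<and> B * B = A)"

definition singvals :: "complex mat \<Rightarrow> real list" where
  "singvals C = eigvals (psd_sqrt (mat_adjoint C * C))"

definition spectral_spread :: "complex mat \<Rightarrow> real list" where
  "spectral_spread A =
     (let m = dim_row A in
      map (\<lambda>i. eigvals A ! i - eigvals A ! (m - 1 - i)) [0..<m div 2])"

definition submajorized :: "real list \<Rightarrow> real list \<Rightarrow> bool" (infix "\<prec>\<^sub>w" 50) where
  "x \<prec>\<^sub>w y \<longleftrightarrow> length x = length y \<and>
     (\<forall>j \<in> {1..length x}.
        sum_list (take j (rev (sort x))) \<le> sum_list (take j (rev (sort y))))"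

definition direct_sum_mat :: "complex mat \<Rightarrow> complex mat \<Rightarrow> complex mat" (infixr "\<oplus>\<^sub>m" 65) where
  "A \<oplus>\<^sub>m B = four_block_mat A (0\<^sub>m (dim_row A) (dim_col B)) (0\<^sub>m (dim_row B) (dim_col A)) B"

end

theory Submission
  imports Defs
begin

text \<open>
Let \<open>V\<close> be a unitary matrix whose columns are eigenvectors of the Hermitian matrix \<open>A1 - A2\<close>, with
eigenvalues \<open>\<mu>\<^sub>i\<close>, and put \<open>B1 = V\<^sup>* A1 V\<close>, \<open>B2 = V\<^sup>* A2 V\<close>. Then \<open>B1 - B2\<close> is diagonal with entries
\<open>\<mu>\<^sub>i\<close>, so each \<open>\<mu>\<^sub>i\<close> is the difference of two diagonal entries of \<open>B = B1 \<oplus>\<^sub>m B2\<close>, one from each block,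
and \<open>\<bar>\<mu>\<^sub>i\<bar>\<close> is the same difference with the larger entry first. The singular values of
\<open>A1 - A2\<close> are the numbers \<open>\<bar>\<mu>\<^sub>i\<bar>\<close> (lemma \<open>singvals_hermitian\<close>), so the sum of the \<open>j\<close> largest of them is a
sum of \<open>j\<close> diagonal entries of \<open>B\<close> minus a sum of \<open>j\<close> other diagonal entries of \<open>B\<close>.

Schur's theorem on the diagonal of a Hermitian matrix (lemma \<open>schur_diagonal_bounds\<close>) bounds the first
sum above by the \<open>j\<close> largest eigenvalues of \<open>B\<close> and the second one below by the \<open>j\<close> smallest. As \<open>B\<close> is
unitarily similar to \<open>A1 \<oplus>\<^sub>m A2\<close>, the resulting bound is the sum of the first \<open>j\<close> entries of the
spectral spread, and these are its \<open>j\<close> largest.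

Three ingredients carry this: the spectral theorem (lemmas \<open>hermitian_diagonalizable\<close> and
\<open>hermitian_eigendecomposition\<close>), uniqueness of positive semidefinite square roots (lemma
\<open>psd_square_root_unique\<close>), which gives access to the definite description behind the singular
values, and Schur's theorem.
\<close>

section \<open>Adjoints and unitary matrices\<close>

lemma dim_mat_adjoint [simp]:
  "dim_row (mat_adjoint A) = dim_col A" "dim_col (mat_adjoint A) = dim_row A"
  by (simp_all add: mat_adjoint_def mat_of_rows_def)

lemma mat_adjoint_carrier [simp]: "A \<in> carrier_mat m n \<Longrightarrow> mat_adjoint A \<in> carrier_mat n m"
  by (intro carrier_matI) auto

lemma index_mat_adjoint [simp]:
  fixes A :: "complex mat"
  shows "i < dim_col A \<Longrightarrow> j < dim_row A \<Longrightarrow> mat_adjoint A $$ (i, j) = cnj (A $$ (j, i))"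
  by (simp add: mat_adjoint_def mat_of_rows_def)

lemma mat_adjoint_adjoint [simp]: "mat_adjoint (mat_adjoint (A :: complex mat)) = A"
  by (rule eq_matI) auto

lemma mat_adjoint_mult:
  fixes A B :: "complex mat"
  assumes "A \<in> carrier_mat l m" "B \<in> carrier_mat m n"
  shows "mat_adjoint (A * B) = mat_adjoint B * mat_adjoint A"
  using assms by (intro eq_matI) (auto simp: scalar_prod_def mult.commute intro!: sum.cong)

lemma mat_adjoint_minus:
  fixes A B :: "complex mat"
  assumes "A \<in> carrier_mat m n" "B \<in> carrier_mat m n"
  shows "mat_adjoint (A - B) = mat_adjoint A - mat_adjoint B"
  using assms by (intro eq_matI) auto

lemma hermitian_mat_index:
  assumes "hermitian_mat A" "A \<in> carrier_mat n n" "i < n" "j < n"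
  shows "A $$ (i, j) = cnj (A $$ (j, i))"
  using assms index_mat_adjoint[of i A j] unfolding hermitian_mat_def by auto

definition unitary_mat :: "nat \<Rightarrow> complex mat \<Rightarrow> bool" where
  "unitary_mat n U \<longleftrightarrow> U \<in> carrier_mat n n \<and> mat_adjoint U * U = 1\<^sub>m n"

lemma unitary_matD:
  assumes "unitary_mat n U"
  shows "U \<in> carrier_mat n n" "mat_adjoint U \<in> carrier_mat n n"
    "mat_adjoint U * U = 1\<^sub>m n" "U * mat_adjoint U = 1\<^sub>m n"
proof -
  show *: "U \<in> carrier_mat n n" "mat_adjoint U * U = 1\<^sub>m n" using assms by (simp_all add: unitary_mat_def)
  thus "mat_adjoint U \<in> carrier_mat n n" by simp
  thus "U * mat_adjoint U = 1\<^sub>m n" 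
    using mat_mult_left_right_inverse[OF _ *] by simp
qed

lemma unitary_mat_mult:
  assumes "unitary_mat n U" "unitary_mat n V"
  shows "unitary_mat n (U * V)"
proof -
  note U = unitary_matD[OF assms(1)] and V = unitary_matD[OF assms(2)]
  have "mat_adjoint (U * V) * (U * V) = mat_adjoint V * (mat_adjoint U * U) * V"
    using U(1,2) V(1,2) by (simp add: mat_adjoint_mult[OF U(1) V(1)]
        assoc_mult_mat[of _ n n _ n _ n] mult_carrier_mat[of _ n n _ n])
  also have "\<dots> = 1\<^sub>m n" using U V by simp
  finally show ?thesis using U V by (simp add: unitary_mat_def)
qed

lemma unitary_columns:
  assumes "unitary_mat n U" "i < n" "j < n"
  shows "(\<Sum>k<n. cnj (U $$ (k, i)) * U $$ (k, j)) = (if i = j then 1 else 0)"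
proof -
  note U = unitary_matD[OF assms(1)]
  have "(mat_adjoint U * U) $$ (i, j) = (\<Sum>k<n. cnj (U $$ (k, i)) * U $$ (k, j))"
    using U(1) assms(2,3) by (simp add: scalar_prod_def atLeast0LessThan)
  thus ?thesis unfolding U using assms by simp
qed

lemma unitary_rows:
  assumes "unitary_mat n U" "i < n" "j < n"
  shows "(\<Sum>k<n. U $$ (i, k) * cnj (U $$ (j, k))) = (if i = j then 1 else 0)"
proof -
  note U = unitary_matD[OF assms(1)]
  have "(U * mat_adjoint U) $$ (i, j) = (\<Sum>k<n. U $$ (i, k) * cnj (U $$ (j, k)))"
    using U(1) assms(2,3) by (simp add: scalar_prod_def atLeast0LessThan)
  thus ?thesis unfolding U using assms by simp
qed

text \<open>Complete \<open>v\<close> to a basis, orthogonalise it, and divide each vector by its norm. Gram-Schmidt leaves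
the first vector unchanged, and \<open>c\<close> is the reciprocal of its norm.\<close>
lemma unitary_extension:
  fixes v :: "complex vec"
  assumes v: "v \<in> carrier_vec n" "v \<noteq> 0\<^sub>v n" and n: "n \<noteq> 0"
  obtains W c where "unitary_mat n W" "col W 0 = c \<cdot>\<^sub>v v"
proof -
  interpret cof_vec_space n "TYPE(complex)" .
  define b where "b = basis_completion v"
  from basis_completion[OF v, folded b_def]
  have b: "distinct b" "\<not> lin_dep (set b)" "set b \<subseteq> carrier_vec n" "hd b = v" "length b = n"
    by auto
  obtain vs where bv: "b = v # vs" using b(4,5) n by (cases b) auto
  define ws where "ws = gram_schmidt n b"
  from gram_schmidt_result[OF b(3,1,2) refl, folded ws_def]
  have ws: "set ws \<subseteq> carrier_vec n" "corthogonal ws" "length ws = n"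
    by (auto simp: b(5))
  have hd: "ws ! 0 = v"
    using gram_schmidt_hd[OF v(1), of vs, folded bv] ws(3) n hd_conv_nth[of ws]
    unfolding ws_def by fastforce
  define nrm :: "complex vec \<Rightarrow> complex" where "nrm w = of_real (1 / sqrt (Re (w \<bullet>c w)))" for w
  define W where "W = mat n n (\<lambda>(i, j). nrm (ws ! j) * ws ! j $ i)"
  have car: "ws ! i \<in> carrier_vec n" if "i < n" for i using ws that by auto
  have orth: "(\<Sum>k<n. cnj (ws ! i $ k) * ws ! j $ k) = ws ! j \<bullet>c ws ! i" if "i < n" "j < n" for i j
    using car[OF that(1)] car[OF that(2)]
    by (auto simp: scalar_prod_def atLeast0LessThan mult.commute intro!: sum.cong)
  have normalised: "nrm w * nrm w * (w \<bullet>c w) = 1" if "w \<bullet>c w \<noteq> 0" for w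
  proof -
    have "w \<bullet>c w \<ge> 0" by (rule conjugate_square_ge_0_vec)
    hence im: "w \<bullet>c w = of_real (Re (w \<bullet>c w))" and re: "Re (w \<bullet>c w) \<ge> 0"
      by (auto simp: less_eq_complex_def complex_eq_iff)
    have "Re (w \<bullet>c w) \<noteq> 0" using that im by auto
    hence "1 / sqrt (Re (w \<bullet>c w)) * (1 / sqrt (Re (w \<bullet>c w))) * Re (w \<bullet>c w) = 1"
      using re by (simp add: field_simps)
    thus ?thesis unfolding nrm_def by (metis im of_real_1 of_real_mult)
  qed
  have "mat_adjoint W * W = 1\<^sub>m n"
  proof (rule eq_matI)
    fix i j assume "i < dim_row (1\<^sub>m n :: complex mat)" "j < dim_col (1\<^sub>m n :: complex mat)"
    hence ij: "i < n" "j < n" by auto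
    have "(mat_adjoint W * W) $$ (i, j) =
        (\<Sum>k<n. nrm (ws ! i) * nrm (ws ! j) * (cnj (ws ! i $ k) * ws ! j $ k))"
      using ij by (auto simp: W_def scalar_prod_def atLeast0LessThan nrm_def intro!: sum.cong)
    also have "\<dots> = nrm (ws ! i) * nrm (ws ! j) * (ws ! j \<bullet>c ws ! i)"
      by (simp add: sum_distrib_left[symmetric] orth ij)
    also have "\<dots> = (if i = j then 1 else 0)"
      using corthogonalD[OF ws(2), of j i] ij ws(3) normalised[of "ws ! i"] by auto
    finally show "(mat_adjoint W * W) $$ (i, j) = 1\<^sub>m n $$ (i, j)" using ij by simp
  qed (auto simp: W_def)
  moreover have "col W 0 = nrm v \<cdot>\<^sub>v v"
    using n v(1) hd by (intro eq_vecI) (auto simp: W_def)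
  ultimately show ?thesis using that[of W "nrm v"] by (auto simp: unitary_mat_def W_def)
qed

section \<open>The spectral theorem for Hermitian matrices\<close>

definition real_diag_mat :: "real list \<Rightarrow> complex mat" where
  "real_diag_mat xs =
     mat (length xs) (length xs) (\<lambda>(i, j). if i = j then of_real (xs ! i) else 0)"

lemma real_diag_mat_carrier [simp]:
  "length xs = n \<Longrightarrow> real_diag_mat xs \<in> carrier_mat n n"
  by (simp add: real_diag_mat_def)

lemma dim_real_diag_mat [simp]:
  "dim_row (real_diag_mat xs) = length xs" "dim_col (real_diag_mat xs) = length xs"
  by (simp_all add: real_diag_mat_def)

lemma index_mult_real_diag:
  assumes "U \<in> carrier_mat m n" "length xs = n" "i < m" "j < n"
  shows "(U * real_diag_mat xs) $$ (i, j) = U $$ (i, j) * of_real (xs ! j)"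
proof -
  have "(U * real_diag_mat xs) $$ (i, j) = (\<Sum>k<n. if k = j then U $$ (i, k) * of_real (xs ! k) else 0)"
    using assms by (auto simp: scalar_prod_def real_diag_mat_def atLeast0LessThan
        intro!: sum.cong simp del: sum.delta sum.delta')
  thus ?thesis using assms by simp
qed

lemma index_real_diag_mult:
  assumes "U \<in> carrier_mat n m" "length xs = n" "i < n" "j < m"
  shows "(real_diag_mat xs * U) $$ (i, j) = of_real (xs ! i) * U $$ (i, j)"
proof -
  have "(real_diag_mat xs * U) $$ (i, j) = (\<Sum>k<n. if k = i then of_real (xs ! k) * U $$ (k, j) else 0)"
    using assms by (auto simp: scalar_prod_def real_diag_mat_def atLeast0LessThan
        intro!: sum.cong simp del: sum.delta sum.delta')
  thus ?thesis using assms by simp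
qed

lemma hermitian_mat_conjugation:
  assumes "A \<in> carrier_mat n n" "hermitian_mat A" "W \<in> carrier_mat n m"
  shows "hermitian_mat (mat_adjoint W * A * W)"
proof -
  have "mat_adjoint (mat_adjoint W * A * W) = mat_adjoint W * mat_adjoint (mat_adjoint W * A)"
    using assms by (intro mat_adjoint_mult[of _ m n]) auto
  also have "mat_adjoint (mat_adjoint W * A) = mat_adjoint A * W"
    using assms by (subst mat_adjoint_mult[of _ m n]) auto
  also have "mat_adjoint W * (mat_adjoint A * W) = mat_adjoint W * A * W"
    using assms by (simp add: hermitian_mat_def assoc_mult_mat[of _ m n _ n _ m])
  finally show ?thesis unfolding hermitian_mat_def .
qed

text \<open>Induction on the size. A unitary \<open>W\<close> whose first column is an eigenvector makes the first
column of \<open>B = W\<^sup>* A W\<close> a multiple of the first unit vector; \<open>B\<close> being Hermitian, the same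
holds for its first row, so that \<open>B\<close> splits into a real number and a smaller Hermitian block \<open>C\<close>.
The diagonalisation is phrased as \<open>A U = U D\<close> rather than \<open>A = U D U\<^sup>*\<close> because this form composes
directly: \<open>A W = W B\<close> and \<open>B V = V D\<close> give \<open>A (W V) = (W V) D\<close>.\<close>
lemma hermitian_diagonalizable:
  assumes "A \<in> carrier_mat n n" "hermitian_mat A"
  shows "\<exists>U xs. unitary_mat n U \<and> length xs = n \<and> A * U = U * real_diag_mat xs"
  using assms
proof (induction n arbitrary: A)
  case 0
  thus ?case
    by (intro exI[of _ "1\<^sub>m 0"] exI[of _ "[]"]) (auto simp: unitary_mat_def)
next
  case (Suc n A)
  let ?N = "Suc n"
  note A = Suc.prems(1)
  obtain as where as: "char_poly A = (\<Prod>a\<leftarrow>as. [:- a, 1:])" "length as = ?N"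
    using char_poly_factorized[OF A] by blast
  obtain e where "eigenvalue A e"
    using as eigenvalue_root_char_poly[OF A] by (cases as) auto
  then obtain v where v: "v \<in> carrier_vec ?N" "v \<noteq> 0\<^sub>v ?N" "A *\<^sub>v v = e \<cdot>\<^sub>v v"
    using A unfolding eigenvalue_def eigenvector_def by auto
  obtain W c where W: "unitary_mat ?N W" "col W 0 = c \<cdot>\<^sub>v v"
    using unitary_extension[OF v(1,2)] by blast
  note W' = unitary_matD[OF W(1)]
  define B where "B = mat_adjoint W * A * W"
  have B: "B \<in> carrier_mat ?N ?N" unfolding B_def using A W'(1,2) by (intro mult_carrier_mat[of _ ?N ?N]) auto
  have herm: "hermitian_mat B"
    unfolding B_def using hermitian_mat_conjugation[OF A Suc.prems(2) W'(1)] .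
  have AW: "A * W = W * B"
  proof -
    have "W * B = (W * mat_adjoint W) * (A * W)"
      unfolding B_def using A W'(1,2)
      by (simp add: assoc_mult_mat[of _ ?N ?N _ ?N _ ?N] mult_carrier_mat[of _ ?N ?N _ ?N])
    thus ?thesis using A W' by simp
  qed
  have col0: "B $$ (i, 0) = (if i = 0 then e else 0)" if "i < ?N" for i
  proof -
    have "A *\<^sub>v col W 0 = e \<cdot>\<^sub>v col W 0"
      using A v W(2) by (simp add: mult_mat_vec smult_smult_assoc mult.commute)
    hence "col (A * W) 0 = e \<cdot>\<^sub>v col W 0" unfolding col_mult2[OF A W'(1) zero_less_Suc] .
    hence ent: "(A * W) $$ (k, 0) = e * W $$ (k, 0)" if "k < ?N" for k
      using A W' that by (auto simp: col_def vec_eq_iff simp del: index_mult_mat(1))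
    have "B = mat_adjoint W * (A * W)" 
      unfolding B_def using A W'(1,2) by (simp add: assoc_mult_mat[of _ ?N ?N _ ?N _ ?N])
    hence "B $$ (i, 0) = (\<Sum>k<?N. cnj (W $$ (k, i)) * (A * W) $$ (k, 0))"
      using that A W' by (auto simp: scalar_prod_def atLeast0LessThan simp del: index_mult_mat(1) intro!: sum.cong)
         (auto simp: scalar_prod_def atLeast0LessThan)
    also have "\<dots> = (\<Sum>k<?N. e * (cnj (W $$ (k, i)) * W $$ (k, 0)))"
      by (intro sum.cong) (auto simp: ent simp del: index_mult_mat(1))
    also have "\<dots> = e * (\<Sum>k<?N. cnj (W $$ (k, i)) * W $$ (k, 0))" by (simp only: sum_distrib_left)
    finally show ?thesis using unitary_columns[OF W(1) that, of 0] by simp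
  qed
  have e: "e = of_real (Re e)"
    using hermitian_mat_index[OF herm B, of 0 0] col0[of 0] by (simp add: complex_eq_iff)
  have row0: "B $$ (0, i) = (if i = 0 then of_real (Re e) else 0)" if "i < ?N" for i
    using hermitian_mat_index[OF herm B, of 0 i] col0[of i] that e by auto
  define C where "C = mat n n (\<lambda>(i, j). B $$ (Suc i, Suc j))"
  have "hermitian_mat C"
    unfolding hermitian_mat_def
    by (intro eq_matI) (auto simp: C_def hermitian_mat_index[OF herm B, symmetric])
  then obtain U xs where U: "unitary_mat n U" "length xs = n" "C * U = U * real_diag_mat xs"
    using Suc.IH[of C] by (auto simp: C_def)
  note U' = unitary_matD[OF U(1)]
  \<comment> \<open>\<open>V\<close> is the block sum of the number 1 and \<open>U\<close>; it diagonalises the block sum \<open>B\<close>.\<close>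
  define V where "V = mat ?N ?N (\<lambda>(i, j). if i = 0 \<or> j = 0 then (if i = j then 1 else 0)
                                      else U $$ (i - 1, j - 1))"
  have Vc: "V \<in> carrier_mat ?N ?N" by (simp add: V_def)
  have V: "unitary_mat ?N V"
    unfolding unitary_mat_def
  proof (intro conjI eq_matI)
    fix i j assume "i < dim_row (1\<^sub>m ?N :: complex mat)" "j < dim_col (1\<^sub>m ?N :: complex mat)"
    hence ij: "i < ?N" "j < ?N" by auto
    have "(mat_adjoint V * V) $$ (i, j) = (\<Sum>k<?N. cnj (V $$ (k, i)) * V $$ (k, j))"
      using ij Vc by (auto simp: scalar_prod_def atLeast0LessThan intro!: sum.cong)
    also have "\<dots> = (if i = j then 1 else 0)"
      unfolding sum.lessThan_Suc_shift
      using ij unitary_columns[OF U(1), of "i - 1" "j - 1"]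
      by (cases i; cases j) (auto simp: V_def)
    finally show "(mat_adjoint V * V) $$ (i, j) = 1\<^sub>m ?N $$ (i, j)" using ij by simp
  qed (auto simp: V_def)
  have BV: "B * V = V * real_diag_mat (Re e # xs)"
  proof (rule eq_matI)
    fix i j assume "i < dim_row (V * real_diag_mat (Re e # xs))" "j < dim_col (V * real_diag_mat (Re e # xs))"
    hence ij: "i < ?N" "j < ?N" using U(2) Vc by auto
    have "(B * V) $$ (i, j) = (\<Sum>k<?N. B $$ (i, k) * V $$ (k, j))"
      using ij Vc B by (auto simp: scalar_prod_def atLeast0LessThan intro!: sum.cong)
    also have "\<dots> = V $$ (i, j) * of_real ((Re e # xs) ! j)"
    proof (cases "i = 0 \<or> j = 0")
      case True
      thus ?thesis unfolding sum.lessThan_Suc_shift using ij e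
        by (cases i; cases j) (auto simp: V_def row0 col0)
    next
      case False
      then obtain i' j' where s: "i = Suc i'" "j = Suc j'" by (cases i; cases j) auto
      have "(\<Sum>k<?N. B $$ (i, k) * V $$ (k, j)) = (\<Sum>k<n. C $$ (i', k) * U $$ (k, j'))"
        unfolding sum.lessThan_Suc_shift using ij by (auto simp: s V_def C_def intro!: sum.cong)
      also have "\<dots> = (C * U) $$ (i', j')"
        using ij s U' by (auto simp: C_def scalar_prod_def atLeast0LessThan intro!: sum.cong)
      also have "\<dots> = U $$ (i', j') * of_real (xs ! j')"
        using ij s U U' by (simp only: index_mult_real_diag[of U n n])
      finally show ?thesis using ij by (simp add: s V_def)
    qed
    also have "\<dots> = (V * real_diag_mat (Re e # xs)) $$ (i, j)"
      using ij U(2) by (subst index_mult_real_diag[OF Vc]) auto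
    finally show "(B * V) $$ (i, j) = (V * real_diag_mat (Re e # xs)) $$ (i, j)" .
  qed (use B Vc U(2) in auto)
  have D: "real_diag_mat (Re e # xs) \<in> carrier_mat ?N ?N" using U(2) by simp
  have "A * (W * V) = A * W * V"
    using A W'(1) Vc by (intro assoc_mult_mat[symmetric])
  also have "\<dots> = W * (B * V)"
    unfolding AW using B W'(1) Vc by (intro assoc_mult_mat)
  also have "\<dots> = W * V * real_diag_mat (Re e # xs)"
    unfolding BV using W'(1) Vc D by (intro assoc_mult_mat[symmetric])
  finally show ?case
    using unitary_mat_mult[OF W(1) V] U(2) by (intro exI[of _ "W * V"] exI[of _ "Re e # xs"]) auto
qed

lemma diagonalized_eq:
  assumes "A \<in> carrier_mat n n" "unitary_mat n U" "D \<in> carrier_mat n n" "A * U = U * D"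
  shows "A = U * D * mat_adjoint U"
proof -
  note U = unitary_matD[OF assms(2)]
  have "U * D * mat_adjoint U = A * (U * mat_adjoint U)"
    unfolding assms(4)[symmetric] using assms(1) U(1,2) by (intro assoc_mult_mat)
  thus ?thesis using assms(1) U(4) by simp
qed

text \<open>Similar matrices have the same characteristic polynomial, and that of a diagonal matrix is already
factored. This holds for any order of the diagonal entries, hence the sorting.\<close>
lemma eigvals_diagonalized:
  assumes A: "A \<in> carrier_mat n n" and U: "unitary_mat n U"
    and xs: "length xs = n" "A * U = U * real_diag_mat xs"
  shows "eigvals A = rev (sort xs)"
proof -
  note U' = unitary_matD[OF U]
  have D: "real_diag_mat xs \<in> carrier_mat n n" using xs(1) by simp
  have "similar_mat A (real_diag_mat xs)"
    by (rule similar_matI[OF _ U'(4,3) diagonalized_eq[OF A U D xs(2)]]) (use A U'(1,2) D in simp)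
  hence "proots (char_poly A) = proots (char_poly (real_diag_mat xs))" by (simp only: char_poly_similar)
  also have "char_poly (real_diag_mat xs) = (\<Prod>a\<leftarrow>diag_mat (real_diag_mat xs). [:- a, 1:])"
    using D by (rule char_poly_upper_triangular) (auto simp: real_diag_mat_def)
  also have "diag_mat (real_diag_mat xs) = map of_real xs"
    by (intro nth_equalityI) (auto simp: diag_mat_def real_diag_mat_def)
  also have "proots (\<Prod>a\<leftarrow>map of_real xs. [:- a, 1:]) = image_mset complex_of_real (mset xs)"
  proof -
    have "(\<Prod>x\<leftarrow>xs. [:- complex_of_real x, 1:]) \<noteq> 0" for xs
      by auto
    thus ?thesis by (induction xs) (simp_all add: proots_mult comp_def del: mult_pCons_left mult_pCons_right)
  qed
  finally have "image_mset Re (proots (char_poly A)) = mset xs"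
    by (simp add: image_mset.compositionality comp_def)
  thus ?thesis unfolding eigvals_def by simp
qed

text \<open>Permuting the columns of the diagonalising matrix puts the eigenvalues into non-increasing order,
that is, turns the diagonal into exactly the list \<open>eigvals A\<close>.\<close>
lemma hermitian_eigendecomposition:
  assumes A: "A \<in> carrier_mat n n" "hermitian_mat A"
  obtains U where "unitary_mat n U" "length (eigvals A) = n" "A * U = U * real_diag_mat (eigvals A)"
proof -
  obtain U xs where U: "unitary_mat n U" and xs: "length xs = n" "A * U = U * real_diag_mat xs"
    using hermitian_diagonalizable[OF A] by blast
  note U' = unitary_matD[OF U]
  have eig: "eigvals A = rev (sort xs)" using eigvals_diagonalized[OF A(1) U xs] .
  hence "mset (eigvals A) = mset xs" by simp
  then obtain p where p: "p permutes {..<n}" "permute_list p xs = eigvals A"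
    using mset_eq_permutation xs(1) by metis
  have nth: "eigvals A ! j = xs ! p j" if "j < n" for j
    using permute_list_nth[of p xs j] p xs(1) that by simp
  have pl: "p j < n" if "j < n" for j using permutes_in_image[OF p(1)] that by simp
  define V where "V = mat n n (\<lambda>(i, j). U $$ (i, p j))"
  have Vc: "V \<in> carrier_mat n n" by (simp add: V_def)
  have len: "length (eigvals A) = n" using eig xs by simp
  have "mat_adjoint V * V = 1\<^sub>m n"
  proof (rule eq_matI)
    fix i j assume "i < dim_row (1\<^sub>m n :: complex mat)" "j < dim_col (1\<^sub>m n :: complex mat)"
    hence ij: "i < n" "j < n" by auto
    have "(mat_adjoint V * V) $$ (i, j) = (\<Sum>k<n. cnj (U $$ (k, p i)) * U $$ (k, p j))"
      using ij by (auto simp: V_def scalar_prod_def atLeast0LessThan intro!: sum.cong)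
    also have "\<dots> = (if i = j then 1 else 0)"
      using unitary_columns[OF U pl[OF ij(1)] pl[OF ij(2)]] permutes_inj[OF p(1)]
      by (auto dest: injD)
    finally show "(mat_adjoint V * V) $$ (i, j) = 1\<^sub>m n $$ (i, j)" using ij by simp
  qed (auto simp: V_def)
  hence V: "unitary_mat n V" using Vc by (simp add: unitary_mat_def)
  have "A * V = V * real_diag_mat (eigvals A)"
  proof (rule eq_matI)
    fix i j assume "i < dim_row (V * real_diag_mat (eigvals A))" "j < dim_col (V * real_diag_mat (eigvals A))"
    hence ij: "i < n" "j < n" using Vc len by auto
    have "(A * V) $$ (i, j) = (A * U) $$ (i, p j)"
      using ij pl[OF ij(2)] A(1) U'(1) by (auto simp: scalar_prod_def V_def intro!: sum.cong)
    also have "\<dots> = V $$ (i, j) * of_real (eigvals A ! j)"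
      unfolding xs(2) index_mult_real_diag[OF U'(1) xs(1) ij(1) pl[OF ij(2)]]
      using ij by (simp add: nth V_def)
    finally show "(A * V) $$ (i, j) = (V * real_diag_mat (eigvals A)) $$ (i, j)"
      unfolding index_mult_real_diag[OF Vc len ij] .
  qed (use A Vc len in auto)
  with V len show ?thesis by (rule that)
qed

lemma eigvals_antimono:
  assumes "i \<le> j" "j < length (eigvals A)"
  shows "eigvals A ! j \<le> eigvals A ! i"
  using assms by (intro sorted_rev_nth_mono) (auto simp: eigvals_def)

section \<open>Singular values of a Hermitian matrix\<close>

lemma adjoint_cscalar_prod:
  fixes M :: "complex mat"
  assumes "M \<in> carrier_mat m n" "x \<in> carrier_vec m" "v \<in> carrier_vec n"
  shows "(mat_adjoint M *\<^sub>v x) \<bullet>c v = x \<bullet>c (M *\<^sub>v v)"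
proof -
  have "(mat_adjoint M *\<^sub>v x) \<bullet>c v = (\<Sum>i<n. \<Sum>k<m. cnj (M $$ (k, i)) * x $ k * cnj (v $ i))"
    using assms by (auto simp: scalar_prod_def atLeast0LessThan sum_distrib_right intro!: sum.cong)
  also have "\<dots> = (\<Sum>k<m. \<Sum>i<n. cnj (M $$ (k, i)) * x $ k * cnj (v $ i))" by (rule sum.swap)
  also have "\<dots> = x \<bullet>c (M *\<^sub>v v)"
    using assms by (auto simp: scalar_prod_def atLeast0LessThan sum_distrib_left mult_ac intro!: sum.cong)
  finally show ?thesis .
qed

lemma psd_mat_gram:
  assumes M: "M \<in> carrier_mat m n"
  shows "psd_mat (mat_adjoint M * M)"
  unfolding psd_mat_def
proof (intro conjI ballI)
  show "hermitian_mat (mat_adjoint M * M)"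
    using M by (simp add: hermitian_mat_def mat_adjoint_mult[of _ n m _ n])
next
  fix v :: "complex vec"
  assume "v \<in> carrier_vec (dim_row (mat_adjoint M * M))"
  hence v: "v \<in> carrier_vec n" using M by simp
  have "(mat_adjoint M * M *\<^sub>v v) \<bullet>c v = (M *\<^sub>v v) \<bullet>c (M *\<^sub>v v)"
    using M v adjoint_cscalar_prod[OF M, of "M *\<^sub>v v" v]
    by (simp add: assoc_mult_mat_vec[of _ n m _ n])
  moreover have "(M *\<^sub>v v) \<bullet>c (M *\<^sub>v v) \<ge> 0" by (rule conjugate_square_ge_0_vec)
  ultimately show "0 \<le> Re ((mat_adjoint M * M *\<^sub>v v) \<bullet>c v)" by (simp add: less_eq_complex_def)
qed

lemma index_conjugation_diag:
  fixes M U :: "complex mat"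
  assumes "M \<in> carrier_mat n n" "U \<in> carrier_mat n m" "k < m"
  shows "(mat_adjoint U * M * U) $$ (k, k) = (M *\<^sub>v col U k) \<bullet>c col U k"
proof -
  have c: "col U k \<in> carrier_vec n" using assms by auto
  have "mat_adjoint U * M * U = mat_adjoint U * (M * U)"
    using assms by (intro assoc_mult_mat[of _ m n _ n]) auto
  hence "(mat_adjoint U * M * U) $$ (k, k) = row (mat_adjoint U) k \<bullet> (M *\<^sub>v col U k)"
    using assms by (simp flip: col_mult2)
  also have "row (mat_adjoint U) k = conjugate (col U k)"
    using assms by (intro eq_vecI) auto
  also have "conjugate (col U k) \<bullet> (M *\<^sub>v col U k) = (M *\<^sub>v col U k) \<bullet>c col U k"
    using c assms by (intro comm_scalar_prod[of _ n]) auto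
  finally show ?thesis .
qed

text \<open>Put \<open>X = B - C\<close>; then \<open>B X + X C = B\<^sup>2 - C\<^sup>2 = 0\<close>. In an orthonormal eigenbasis of \<open>X\<close>, with
eigenvalues \<open>x\<^sub>k\<close>, the diagonal entries of this equation read \<open>x\<^sub>k (b\<^sub>k + c\<^sub>k) = 0\<close>, where \<open>b\<^sub>k\<close> and \<open>c\<^sub>k\<close>
are the diagonal entries of \<open>B\<close> and \<open>C\<close>. These are nonnegative and satisfy \<open>b\<^sub>k - c\<^sub>k = x\<^sub>k\<close>, so every
\<open>x\<^sub>k\<close> vanishes and with it \<open>X\<close>.\<close>
lemma psd_square_root_unique:
  assumes B: "B \<in> carrier_mat n n" "psd_mat B" and C: "C \<in> carrier_mat n n" "psd_mat C"
    and eq: "B * B = C * C"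
  shows "B = C"
proof -
  define X where "X = B - C"
  have X: "X \<in> carrier_mat n n" using B C by (auto simp: X_def)
  have "hermitian_mat X"
    using B C by (auto simp: X_def hermitian_mat_def psd_mat_def mat_adjoint_minus[of _ n n])
  then obtain U xs where U: "unitary_mat n U" and xs: "length xs = n" "X * U = U * real_diag_mat xs"
    using hermitian_diagonalizable[OF X] by blast
  note U' = unitary_matD[OF U]
  let ?D = "real_diag_mat xs"
  have D: "?D \<in> carrier_mat n n" using xs by simp
  define conj_by where "conj_by M = mat_adjoint U * M * U" for M
  have conj_c: "conj_by M \<in> carrier_mat n n" if "M \<in> carrier_mat n n" for M
    unfolding conj_by_def using that U'(1,2) by (intro mult_carrier_mat[of _ n n]) auto
  have conj_mult: "conj_by (M * N) = conj_by M * conj_by N"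
    if M: "M \<in> carrier_mat n n" and N: "N \<in> carrier_mat n n" for M N
  proof -
    have "conj_by M * conj_by N = mat_adjoint U * M * (U * mat_adjoint U) * N * U"
      unfolding conj_by_def using M N U'(1,2)
      by (simp add: assoc_mult_mat[of _ n n _ n _ n] mult_carrier_mat[of _ n n _ n])
    also have "\<dots> = mat_adjoint U * M * N * U"
      unfolding U'(4) using M N U'(1,2) mult_carrier_mat[OF U'(2) M] by simp
    also have "\<dots> = conj_by (M * N)"
      unfolding conj_by_def using M N U'(1,2)
      by (simp add: assoc_mult_mat[of _ n n _ n _ n] mult_carrier_mat[of _ n n _ n])
    finally show ?thesis by simp
  qed
  have conj_X: "conj_by X = ?D"
  proof -
    have "conj_by X = mat_adjoint U * (X * U)"
      unfolding conj_by_def using X U'(1,2) by (intro assoc_mult_mat)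
    also have "\<dots> = mat_adjoint U * U * ?D"
      unfolding xs(2) using D U'(1,2) by (intro assoc_mult_mat[symmetric])
    finally show ?thesis unfolding U'(3) left_mult_one_mat[OF D] .
  qed
  have "B * X + X * C = 0\<^sub>m n n"
  proof -
    have "B * X = B * B - B * C" "X * C = B * C - C * C"
      unfolding X_def using B C
      by (simp_all add: mult_minus_distrib_mat[of _ n n _ n] minus_mult_distrib_mat[of _ n n _ _ n])
    thus ?thesis using B C eq by (intro eq_matI) auto
  qed
  hence sum0: "conj_by B * ?D + ?D * conj_by C = 0\<^sub>m n n"
  proof -
    have "conj_by B * ?D + ?D * conj_by C = conj_by (B * X) + conj_by (X * C)"
      using conj_mult[OF B(1) X] conj_mult[OF X C(1)] conj_X by simp
    also have "\<dots> = conj_by (B * X + X * C)"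
    proof -
      have c: "B * X \<in> carrier_mat n n" "X * C \<in> carrier_mat n n" using B C X by auto
      have "mat_adjoint U * (B * X + X * C) = mat_adjoint U * (B * X) + mat_adjoint U * (X * C)"
        using U'(2) c by (rule mult_add_distrib_mat)
      moreover have "(mat_adjoint U * (B * X) + mat_adjoint U * (X * C)) * U =
          mat_adjoint U * (B * X) * U + mat_adjoint U * (X * C) * U"
        by (rule add_mult_distrib_mat[of _ n n _ _ n]) (use U'(1) mult_carrier_mat[OF U'(2)] c in auto)
      ultimately show ?thesis unfolding conj_by_def by simp
    qed
    also have "\<dots> = 0\<^sub>m n n"
      unfolding \<open>B * X + X * C = 0\<^sub>m n n\<close> conj_by_def using U'(1,2) by simp
    finally show ?thesis .
  qed
  have nonneg: "0 \<le> Re (conj_by M $$ (k, k))"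
    if "M \<in> carrier_mat n n" "psd_mat M" "k < n" for M k
    unfolding conj_by_def index_conjugation_diag[OF that(1) U'(1) that(3)]
    using that U'(1) by (auto simp: psd_mat_def)
  have "xs ! k = 0" if k: "k < n" for k
  proof -
    have "(conj_by B * ?D + ?D * conj_by C) $$ (k, k) =
        (conj_by B * ?D) $$ (k, k) + (?D * conj_by C) $$ (k, k)"
      using k D conj_c[OF C(1)] xs(1) by (intro index_add_mat) auto
    hence "conj_by B $$ (k, k) * xs ! k + xs ! k * conj_by C $$ (k, k) = 0"
      unfolding sum0 index_mult_real_diag[OF conj_c[OF B(1)] xs(1) k k]
        index_real_diag_mult[OF conj_c[OF C(1)] xs(1) k k] using k by simp
    hence "Re (conj_by B $$ (k, k) * xs ! k + xs ! k * conj_by C $$ (k, k)) = 0" by simp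
    hence *: "xs ! k * (Re (conj_by B $$ (k, k)) + Re (conj_by C $$ (k, k))) = 0"
      by (simp add: algebra_simps)
    have "conj_by X = conj_by B - conj_by C"
    proof -
      have "mat_adjoint U * X = mat_adjoint U * B - mat_adjoint U * C"
        unfolding X_def using U'(2) B(1) C(1) by (rule mult_minus_distrib_mat)
      thus ?thesis unfolding conj_by_def
        using minus_mult_distrib_mat[OF mult_carrier_mat[OF U'(2) B(1)]
            mult_carrier_mat[OF U'(2) C(1)] U'(1)] by (simp only:)
    qed
    hence "?D $$ (k, k) = conj_by B $$ (k, k) - conj_by C $$ (k, k)"
      unfolding conj_X using k conj_c[OF B(1)] conj_c[OF C(1)] by simp
    moreover have "?D $$ (k, k) = xs ! k" using k xs(1) by (simp add: real_diag_mat_def)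
    ultimately have "xs ! k = Re (conj_by B $$ (k, k)) - Re (conj_by C $$ (k, k))"
      by (metis Re_complex_of_real minus_complex.sel(1))
    with * nonneg[OF B k] nonneg[OF C k] show ?thesis by auto
  qed
  hence "?D = 0\<^sub>m n n" using xs(1) by (intro eq_matI) (auto simp: real_diag_mat_def)
  hence "X = 0\<^sub>m n n" using diagonalized_eq[OF X U D xs(2)] U'(1,2) by simp
  hence "B $$ (i, j) - C $$ (i, j) = 0" if "i < n" "j < n" for i j
    using that B C index_minus_mat(1)[of i C j B] unfolding X_def by auto
  thus ?thesis using B C by (intro eq_matI) auto
qed

lemma psd_sqrt_eqI:
  assumes "B \<in> carrier_mat n n" "psd_mat B" "B * B = A"
  shows "psd_sqrt A = B"
  unfolding psd_sqrt_def
proof (rule the_equality)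
  fix C assume C: "psd_mat C \<and> C * C = A"
  have "dim_row C = n" using C assms by (metis carrier_matD(1) index_mult_mat(2))
  moreover have "dim_col C = dim_row C"
    using C unfolding psd_mat_def hermitian_mat_def by (metis dim_mat_adjoint(1))
  ultimately have "C \<in> carrier_mat n n" by auto
  thus "C = B" using psd_square_root_unique C assms by metis
qed (use assms in auto)

text \<open>If \<open>A = U D U\<^sup>*\<close>, then \<open>B = U \<bar>D\<bar> U\<^sup>*\<close> is a square root of \<open>A\<^sup>* A = A\<^sup>2\<close> with the eigenvalues \<open>\<bar>x\<bar>\<close>. It is
written as the Gram matrix of \<open>M = E U\<^sup>*\<close> with \<open>E = \<bar>D\<bar>\<^sup>1\<^sup>/\<^sup>2\<close> because a Gram matrix is visibly
positive semidefinite.\<close>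
lemma singvals_hermitian:
  assumes A: "A \<in> carrier_mat n n" "hermitian_mat A"
  shows "singvals A = rev (sort (map abs (eigvals A)))"
proof -
  define xs where "xs = eigvals A"
  obtain U where U: "unitary_mat n U" and xs: "length xs = n" "A * U = U * real_diag_mat xs"
    using hermitian_eigendecomposition[OF A] unfolding xs_def by blast
  note U' = unitary_matD[OF U]
  let ?D = "\<lambda>f. real_diag_mat (map f xs)"
  have D: "?D f \<in> carrier_mat n n" for f using xs(1) by simp
  have DD: "?D f * ?D g = ?D (\<lambda>x. f x * g x)" for f g
  proof (rule eq_matI)
    fix i j assume "i < dim_row (?D (\<lambda>x. f x * g x))" "j < dim_col (?D (\<lambda>x. f x * g x))"
    hence ij: "i < n" "j < n" using xs(1) by auto
    have "(?D f * ?D g) $$ (i, j) = ?D f $$ (i, j) * of_real (map g xs ! j)"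
      using D xs(1) ij by (intro index_mult_real_diag[of _ n n]) auto
    thus "(?D f * ?D g) $$ (i, j) = ?D (\<lambda>x. f x * g x) $$ (i, j)"
      using ij xs(1) by (auto simp: real_diag_mat_def)
  qed auto
  define E where "E = ?D (\<lambda>x. sqrt \<bar>x\<bar>)"
  have E: "E \<in> carrier_mat n n" unfolding E_def by (rule D)
  have adjE: "mat_adjoint E = E" unfolding E_def
    by (intro eq_matI) (auto simp: real_diag_mat_def)
  define M where "M = E * mat_adjoint U"
  have M: "M \<in> carrier_mat n n" unfolding M_def using E U'(2) by simp
  define B where "B = mat_adjoint M * M"
  have B: "B \<in> carrier_mat n n" unfolding B_def using M by (intro mult_carrier_mat[of _ n n]) auto
  have BU: "B * U = U * ?D abs"
  proof -
    have adjM: "mat_adjoint M = U * E"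
      unfolding M_def using mat_adjoint_mult[OF E U'(2)] adjE by simp
    have "B * U = mat_adjoint M * (M * U)" unfolding B_def using M U'(1) by (intro assoc_mult_mat) auto
    also have "M * U = E * (mat_adjoint U * U)" unfolding M_def using E U'(1,2) by (intro assoc_mult_mat)
    also have "\<dots> = E" using U'(3) E by simp
    also have "mat_adjoint M * E = U * (E * E)" unfolding adjM using E U'(1) by (intro assoc_mult_mat)
    also have "E * E = ?D abs" unfolding E_def DD by simp
    finally show ?thesis .
  qed
  have AU: "A * U = U * ?D (\<lambda>x. x)" using xs(2) by simp
  have square: "(M * M) * U = U * ?D (\<lambda>x. f x * f x)"
    if "M \<in> carrier_mat n n" "M * U = U * ?D f" for M f
  proof -
    have "(M * M) * U = M * (M * U)" using that(1) U'(1) by (intro assoc_mult_mat)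
    also have "M * U = U * ?D f" by (rule that(2))
    also have "M * (U * ?D f) = M * U * ?D f"
      using that(1) U'(1) D by (intro assoc_mult_mat[symmetric])
    also have "\<dots> = U * (?D f * ?D f)"
      unfolding that(2) using U'(1) D by (intro assoc_mult_mat)
    finally show ?thesis unfolding DD .
  qed
  have AA: "A * A = U * ?D (\<lambda>x. x * x) * mat_adjoint U"
    using A by (intro diagonalized_eq[OF _ U D square[OF A(1) AU]]) auto
  have "B * B = U * ?D (\<lambda>x. \<bar>x\<bar> * \<bar>x\<bar>) * mat_adjoint U"
    using B by (intro diagonalized_eq[OF _ U D square[OF B BU]]) auto
  also have "\<dots> = mat_adjoint A * A" using A(2) by (simp add: AA hermitian_mat_def)
  finally have "psd_sqrt (mat_adjoint A * A) = B"
    using psd_mat_gram[OF M] B by (intro psd_sqrt_eqI[of _ n]) (auto simp: B_def)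
  hence "singvals A = eigvals B" by (simp add: singvals_def)
  also have "\<dots> = rev (sort (map abs xs))"
    by (rule eigvals_diagonalized[OF B U]) (simp_all add: xs(1) BU)
  finally show ?thesis unfolding xs_def .
qed

section \<open>Diagonal entries and eigenvalues\<close>

text \<open>Weights in \<open>[0, 1]\<close> with total mass \<open>card T\<close> are best spent on the largest values, those on \<open>T\<close>.
With \<open>c\<close> separating the values on \<open>T\<close> from the others, each product of \<open>w k - of_bool (k \<in> T)\<close> and
\<open>a k - c\<close> is nonpositive, and the constant \<open>c\<close> cancels on summing because both weightings have the
same mass.\<close>
lemma weighted_sum_le_sum_of_largest:
  fixes a w :: "'i \<Rightarrow> real"
  assumes "finite K" "T \<subseteq> K"
    and w: "\<And>k. k \<in> K \<Longrightarrow> 0 \<le> w k \<and> w k \<le> 1" "sum w K = card T"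
    and T: "\<And>k. k \<in> T \<Longrightarrow> c \<le> a k" "\<And>k. k \<in> K - T \<Longrightarrow> a k \<le> c"
  shows "(\<Sum>k\<in>K. w k * a k) \<le> sum a T"
proof -
  have ind: "(\<Sum>k\<in>K. of_bool (k \<in> T) * f k) = sum f T" for f :: "'i \<Rightarrow> real"
    using assms(1,2) by (simp add: Int_absorb1)
  have "(\<Sum>k\<in>K. (w k - of_bool (k \<in> T)) * (a k - c)) \<le> 0"
    using w(1) T by (intro sum_nonpos) (auto simp: mult_nonpos_nonneg mult_nonneg_nonpos of_bool_def)
  moreover have "(\<Sum>k\<in>K. (w k - of_bool (k \<in> T)) * (a k - c)) =
      (\<Sum>k\<in>K. w k * a k) - (\<Sum>k\<in>K. of_bool (k \<in> T) * a k)
        - c * (sum w K - (\<Sum>k\<in>K. of_bool (k \<in> T) * 1))"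
    by (simp add: algebra_simps sum.distrib sum_subtractf sum_distrib_left)
  ultimately show ?thesis unfolding ind w(2) by simp
qed

text \<open>With \<open>B = U D U\<^sup>*\<close>, the diagonal entry \<open>B\<^sub>p\<^sub>p\<close> is the average of the eigenvalues with weights
\<open>\<bar>U\<^sub>p\<^sub>k\<bar>\<^sup>2\<close>. These weights form a doubly stochastic matrix, so summing over \<open>p \<in> S\<close> yields weights in
\<open>[0, 1]\<close> of total mass \<open>card S\<close>. The lower bound is the upper one for the negated eigenvalues.\<close>
lemma schur_diagonal_bounds:
  assumes B: "B \<in> carrier_mat m m" "hermitian_mat B" and S: "S \<subseteq> {..<m}"
  shows "(\<Sum>p\<in>S. Re (B $$ (p, p))) \<le> (\<Sum>k<card S. eigvals B ! k)"
    and "(\<Sum>k<card S. eigvals B ! (m - 1 - k)) \<le> (\<Sum>p\<in>S. Re (B $$ (p, p)))"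
proof -
  define e where "e = (\<lambda>k. eigvals B ! k)"
  obtain U where U: "unitary_mat m U" and len: "length (eigvals B) = m"
    and BU: "B * U = U * real_diag_mat (eigvals B)"
    using hermitian_eigendecomposition[OF B] by blast
  note U' = unitary_matD[OF U]
  have D: "real_diag_mat (eigvals B) \<in> carrier_mat m m" using len by simp
  have fin: "finite S" using S finite_subset by blast
  have cS: "card S \<le> m" using card_mono[OF _ S] by simp
  define w where "w k = (\<Sum>p\<in>S. (cmod (U $$ (p, k)))\<^sup>2)" for k
  have diag: "Re (B $$ (p, p)) = (\<Sum>k<m. (cmod (U $$ (p, k)))\<^sup>2 * e k)" if "p < m" for p
  proof -
    have "B $$ (p, p) = (U * real_diag_mat (eigvals B) * mat_adjoint U) $$ (p, p)"
      using diagonalized_eq[OF B(1) U D BU] by simp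
    also have "\<dots> = (\<Sum>k<m. (U * real_diag_mat (eigvals B)) $$ (p, k) * cnj (U $$ (p, k)))"
      using that U'(1) D len by (simp add: scalar_prod_def atLeast0LessThan)
    also have "\<dots> = (\<Sum>k<m. of_real ((cmod (U $$ (p, k)))\<^sup>2 * e k))"
      using that by (intro sum.cong refl)
        (simp add: index_mult_real_diag[OF U'(1) len] complex_norm_square e_def mult_ac
          del: index_mult_mat(1) of_real_power)
    finally show ?thesis by simp
  qed
  have "(\<Sum>p\<in>S. Re (B $$ (p, p))) = (\<Sum>p\<in>S. \<Sum>k<m. (cmod (U $$ (p, k)))\<^sup>2 * e k)"
    using S by (intro sum.cong) (auto simp: diag)
  also have "\<dots> = (\<Sum>k<m. w k * e k)"
    unfolding w_def sum_distrib_right by (rule sum.swap)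
  finally have eq: "(\<Sum>p\<in>S. Re (B $$ (p, p))) = (\<Sum>k<m. w k * e k)" .
  have col1: "(\<Sum>p<m. (cmod (U $$ (p, k)))\<^sup>2) = 1" if "k < m" for k
  proof -
    have "of_real (\<Sum>p<m. (cmod (U $$ (p, k)))\<^sup>2) = (1 :: complex)"
      using unitary_columns[OF U that that] 
      by (simp add: complex_norm_square mult.commute del: of_real_power)
    thus ?thesis by (metis of_real_eq_1_iff)
  qed
  have row1: "(\<Sum>k<m. (cmod (U $$ (p, k)))\<^sup>2) = 1" if "p < m" for p
  proof -
    have "of_real (\<Sum>k<m. (cmod (U $$ (p, k)))\<^sup>2) = (1 :: complex)"
      using unitary_rows[OF U that that] 
      by (simp add: complex_norm_square del: of_real_power)
    thus ?thesis by (metis of_real_eq_1_iff)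
  qed
  have w01: "0 \<le> w k \<and> w k \<le> 1" if "k \<in> {..<m}" for k
    using that sum_mono2[OF _ S, of "\<lambda>p. (cmod (U $$ (p, k)))\<^sup>2"] col1[of k]
    by (auto simp: w_def sum_nonneg)
  have "sum w {..<m} = (\<Sum>p\<in>S. \<Sum>k<m. (cmod (U $$ (p, k)))\<^sup>2)"
    unfolding w_def by (rule sum.swap)
  also have "\<dots> = (\<Sum>p\<in>S. 1)" using S by (intro sum.cong) (auto simp: row1)
  finally have wsum: "sum w {..<m} = card S" by simp
  have mono: "e j \<le> e i" if "i \<le> j" "j < m" for i j
    unfolding e_def using eigvals_antimono that len by simp
  show "(\<Sum>p\<in>S. Re (B $$ (p, p))) \<le> (\<Sum>k<card S. eigvals B ! k)"
  proof -
    have "(\<Sum>k<m. w k * e k) \<le> sum e {..<card S}"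
      using cS wsum w01 mono
      by (intro weighted_sum_le_sum_of_largest[where c = "e (card S - 1)"]) auto
    thus ?thesis unfolding eq e_def .
  qed
  show "(\<Sum>k<card S. eigvals B ! (m - 1 - k)) \<le> (\<Sum>p\<in>S. Re (B $$ (p, p)))"
  proof -
    let ?T = "(\<lambda>k. m - 1 - k) ` {..<card S}"
    have inj: "inj_on (\<lambda>k. m - 1 - k) {..<card S}" using cS by (auto intro!: inj_onI)
    have T: "?T = {m - card S..<m}"
    proof (intro equalityI subsetI)
      fix x assume "x \<in> {m - card S..<m}"
      thus "x \<in> ?T" using cS by (intro image_eqI[of _ _ "m - 1 - x"]) auto
    qed (use cS in auto)
    \<comment> \<open>The threshold is the largest of the \<open>card S\<close> smallest eigenvalues, at index \<open>m - card S\<close>; the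
      minimum keeps the index below \<open>m\<close> when \<open>S\<close> is empty.\<close>
    have "(\<Sum>k<m. w k * - e k) \<le> (\<Sum>k\<in>?T. - e k)"
      unfolding T using cS wsum w01
      by (intro weighted_sum_le_sum_of_largest[where c = "- e (min (m - 1) (m - card S))"]) (auto intro!: mono)
    moreover have "(\<Sum>k\<in>?T. - e k) = - (\<Sum>k<card S. e (m - 1 - k))"
      unfolding sum.reindex[OF inj] comp_def by (rule sum_negf)
    ultimately show ?thesis unfolding eq by (simp add: sum_negf e_def)
  qed
qed

section \<open>Singular values of a difference and the spectral spread\<close>

lemma sum_of_largest_eq_sum_subset:
  fixes xs :: "real list"
  assumes "j \<le> length xs"
  obtains S where "S \<subseteq> {..<length xs}" "card S = j"
    "sum_list (take j (rev (sort xs))) = (\<Sum>i\<in>S. xs ! i)"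
proof -
  have "mset (rev (sort xs)) = mset xs" by simp
  then obtain p where p: "p permutes {..<length xs}" "permute_list p xs = rev (sort xs)"
    using mset_eq_permutation by metis
  have inj: "inj_on p {..<j}" using permutes_inj[OF p(1)] by (rule inj_on_subset) simp
  have "sum_list (take j (rev (sort xs))) = (\<Sum>i<j. rev (sort xs) ! i)"
    using assms by (simp add: sum_list_sum_nth atLeast0LessThan)
  also have "\<dots> = (\<Sum>i<j. xs ! p i)"
    using assms permute_list_nth[OF p(1)] p(2) by (intro sum.cong) auto
  also have "\<dots> = (\<Sum>i\<in>p ` {..<j}. xs ! i)" by (simp add: sum.reindex[OF inj])
  finally show ?thesis
    using that[of "p ` {..<j}"] assms permutes_in_image[OF p(1)] card_image[OF inj] by force
qed

text \<open>The characteristic polynomial is multiplicative over the blocks and invariant under similarity, so the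
two blocks may be conjugated without forming the block sum of \<open>V\<close> with itself.\<close>
lemma eigvals_direct_sum_unitary_conjugation:
  assumes A: "A1 \<in> carrier_mat n n" "A2 \<in> carrier_mat n n" and V: "unitary_mat n V"
  shows "eigvals ((mat_adjoint V * A1 * V) \<oplus>\<^sub>m (mat_adjoint V * A2 * V)) = eigvals (A1 \<oplus>\<^sub>m A2)"
proof -
  note V' = unitary_matD[OF V]
  have cp: "char_poly (B1 \<oplus>\<^sub>m B2) = char_poly B1 * char_poly B2"
    if "B1 \<in> carrier_mat n n" "B2 \<in> carrier_mat n n" for B1 B2
    using that char_poly_factorized
    by (intro char_poly_0_block[of _ B1 "0\<^sub>m n n" n n B2]) (auto simp: direct_sum_mat_def)
  have c: "mat_adjoint V * B * V \<in> carrier_mat n n" if "B \<in> carrier_mat n n" for B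
    using that V'(1,2) by (intro mult_carrier_mat[of _ n n]) auto
  have "char_poly (mat_adjoint V * B * V) = char_poly B" if "B \<in> carrier_mat n n" for B
    using that V' c[OF that]
    by (intro char_poly_similar similar_matI[of _ _ "mat_adjoint V" V n]) auto
  thus ?thesis using A c unfolding eigvals_def by (simp add: cp)
qed

theorem theorem2p12:
  fixes A1 A2 :: "complex mat" and n :: nat
  assumes "A1 \<in> carrier_mat n n" and "A2 \<in> carrier_mat n n"
    and "hermitian_mat A1" and "hermitian_mat A2"
  shows "singvals (A1 - A2) \<prec>\<^sub>w spectral_spread (A1 \<oplus>\<^sub>m A2)"
proof -
  note A = assms(1,2)
  have D: "A1 - A2 \<in> carrier_mat n n" "hermitian_mat (A1 - A2)"
    using assms by (auto simp: hermitian_mat_def mat_adjoint_minus[OF A])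
  define \<mu> where "\<mu> = eigvals (A1 - A2)"
  obtain V where V: "unitary_mat n V" and len: "length \<mu> = n"
    and DV: "(A1 - A2) * V = V * real_diag_mat \<mu>"
    using hermitian_eigendecomposition[OF D] unfolding \<mu>_def by blast
  note V' = unitary_matD[OF V]
  define B1 where "B1 = mat_adjoint V * A1 * V"
  define B2 where "B2 = mat_adjoint V * A2 * V"
  have c: "B1 \<in> carrier_mat n n" "B2 \<in> carrier_mat n n"
    unfolding B1_def B2_def using A V'(1,2) by (auto intro!: mult_carrier_mat[of _ n n])
  have h: "hermitian_mat B1" "hermitian_mat B2"
    unfolding B1_def B2_def using assms V'(1) by (auto intro: hermitian_mat_conjugation)
  have diff: "B1 $$ (i, i) - B2 $$ (i, i) = of_real (\<mu> ! i)" if "i < n" for i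
  proof -
    have "B1 - B2 = (mat_adjoint V * A1 - mat_adjoint V * A2) * V"
      unfolding B1_def B2_def using A V'(1,2)
      by (intro minus_mult_distrib_mat[of _ n n _ _ n, symmetric]) auto
    also have "mat_adjoint V * A1 - mat_adjoint V * A2 = mat_adjoint V * (A1 - A2)"
      using A V'(2) by (intro mult_minus_distrib_mat[symmetric])
    also have "mat_adjoint V * (A1 - A2) * V = mat_adjoint V * (V * real_diag_mat \<mu>)"
      unfolding DV[symmetric] using D V'(1,2) by (intro assoc_mult_mat)
    also have "\<dots> = mat_adjoint V * V * real_diag_mat \<mu>"
      using V'(1,2) len by (intro assoc_mult_mat[symmetric]) auto
    also have "\<dots> = real_diag_mat \<mu>" using V'(3) len by simp
    finally have "(B1 - B2) $$ (i, i) = real_diag_mat \<mu> $$ (i, i)" by simp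
    thus ?thesis using that c len by (simp add: real_diag_mat_def)
  qed
  define B where "B = B1 \<oplus>\<^sub>m B2"
  define e where "e = eigvals B"
  have Bc: "B \<in> carrier_mat (n + n) (n + n)"
    unfolding B_def direct_sum_mat_def using c by simp
  have Bh: "hermitian_mat B"
    unfolding hermitian_mat_def
  proof (rule eq_matI)
    fix i j assume "i < dim_row B" "j < dim_col B"
    hence ij: "i < n + n" "j < n + n" using Bc by auto
    show "mat_adjoint B $$ (i, j) = B $$ (i, j)"
      using ij c Bc hermitian_mat_index[OF h(1) c(1), of i j] hermitian_mat_index[OF h(2) c(2), of "i - n" "j - n"]
      by (auto simp: B_def direct_sum_mat_def)
  qed (use Bc in auto)
  have B_diag: "B $$ (i, i) = B1 $$ (i, i)" "B $$ (n + i, n + i) = B2 $$ (i, i)" if "i < n" for i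
    using that c by (auto simp: B_def direct_sum_mat_def)
  have eA: "eigvals (A1 \<oplus>\<^sub>m A2) = e"
    unfolding e_def B_def B1_def B2_def
    using eigvals_direct_sum_unitary_conjugation[OF A V] by simp
  have elen: "length e = n + n" unfolding e_def
    using hermitian_eigendecomposition[OF Bc Bh] by blast
  have mono: "e ! j \<le> e ! i" if "i \<le> j" "j < n + n" for i j
    using eigvals_antimono[of i j B] that elen unfolding e_def by simp
  define y where "y = spectral_spread (A1 \<oplus>\<^sub>m A2)"
  have y: "y = map (\<lambda>i. e ! i - e ! (n + n - 1 - i)) [0..<n]"
    using A unfolding y_def spectral_spread_def eA by (simp add: direct_sum_mat_def Let_def mult_2[symmetric])
  have "sorted (rev y)"
    unfolding sorted_rev_iff_nth_mono y by (auto intro!: diff_mono mono)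
  hence "sort y = rev y" by (intro properties_for_sort) simp_all
  hence top_y: "sum_list (take j (rev (sort y))) = (\<Sum>i<j. e ! i) - (\<Sum>i<j. e ! (n + n - 1 - i))"
    if "j \<le> n" for j
    using that by (simp add: y take_map interv_sum_list_conv_sum_set_nat atLeast0LessThan sum_subtractf)
  define x where "x = singvals (A1 - A2)"
  have x: "x = rev (sort (map abs \<mu>))"
    unfolding x_def \<mu>_def by (rule singvals_hermitian[OF D])
  have "sum_list (take j (rev (sort x))) \<le> sum_list (take j (rev (sort y)))" if j: "j \<le> n" for j
  proof -
    obtain S where "S \<subseteq> {..<length (map abs \<mu>)}" and "card S = j"
      and top_x: "sum_list (take j (rev (sort (map abs \<mu>)))) = (\<Sum>i\<in>S. map abs \<mu> ! i)"
      by (rule sum_of_largest_eq_sum_subset[of j "map abs \<mu>"]) (use j len in auto)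
    hence S: "S \<subseteq> {..<n}" "card S = j" using len by auto
    \<comment> \<open>\<open>p i\<close> and \<open>q i\<close> are the positions of the \<open>i\<close>-th diagonal entries of the two blocks of \<open>B\<close>,
      ordered so that the larger entry is at \<open>p i\<close>.\<close>
    define p where "p i = (if \<mu> ! i \<ge> 0 then i else n + i)" for i
    define q where "q i = (if \<mu> ! i \<ge> 0 then n + i else i)" for i
    have inj: "inj_on p S" "inj_on q S" and sub: "p ` S \<subseteq> {..<n + n}" "q ` S \<subseteq> {..<n + n}"
      using S(1) by (auto simp: p_def q_def inj_on_def split: if_splits)
    have "sort x = sort (map abs \<mu>)"
      unfolding x by (intro properties_for_sort) simp_all
    hence "sum_list (take j (rev (sort x))) = (\<Sum>i\<in>S. map abs \<mu> ! i)" using top_x by simp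
    also have "\<dots> = (\<Sum>i\<in>S. Re (B $$ (p i, p i)) - Re (B $$ (q i, q i)))"
    proof (intro sum.cong refl)
      fix i assume "i \<in> S"
      hence i: "i < n" using S by auto
      have "Re (B1 $$ (i, i)) - Re (B2 $$ (i, i)) = \<mu> ! i"
        using diff[OF i] by (metis Re_complex_of_real minus_complex.sel(1))
      thus "map abs \<mu> ! i = Re (B $$ (p i, p i)) - Re (B $$ (q i, q i))"
        using i len B_diag[OF i] by (auto simp: p_def q_def)
    qed
    also have "\<dots> = (\<Sum>i\<in>p ` S. Re (B $$ (i, i))) - (\<Sum>i\<in>q ` S. Re (B $$ (i, i)))"
      by (simp add: sum_subtractf sum.reindex[OF inj(1)] sum.reindex[OF inj(2)])
    also have "\<dots> \<le> (\<Sum>i<j. e ! i) - (\<Sum>i<j. e ! (n + n - 1 - i))"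
      using schur_diagonal_bounds(1)[OF Bc Bh sub(1)] schur_diagonal_bounds(2)[OF Bc Bh sub(2)]
      by (intro diff_mono) (simp_all add: card_image inj S(2) e_def)
    finally show ?thesis using top_y[OF j] by simp
  qed
  moreover have "length x = n" "length y = n" by (simp_all add: x len y)
  ultimately show ?thesis unfolding submajorized_def x_def[symmetric] y_def[symmetric] by auto
qed

end
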